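(* Let $\tilde F_i:\tilde X\to Y$, $i=0,\dots,r_{\mathrm{num}}-1$, be the linear MRI operators described in the context, and assume $\|\tilde F_i\|\le 1$ for all $i$. Let $\mathcal P_0\in\tilde X$, $\rho>0$, $\mathcal M_0,\dots,\mathcal M_{r_{\mathrm{num}}-1}\in Y$, and assume there is $\mathcal P^*\in B_{\rho/2}(\mathcal P_0)$ with $\tilde F_i(\mathcal P^* )=\mathcal M_i$ for all $i=0,\dots,r_{\mathrm{num}}-1$. Let $\mathcal M_i^\delta\in Y$ satisfy $\|\mathcal M_i^\delta-\mathcal M_i\|\le\delta_i$, where either $\delta_i>0$ for all $i$ (noisy data) or $\delta_i=0$ for all $i$ (exact data). Let $(\mathcal P_k^\delta)_{k\ge0}$ be the loping Landweber-Kaczmarz (lLK) iteration (relaxation parameters $\alpha_k\equiv1$) started at $\mathcal P_0$, and $k_*^\delta$ its stopping index. Then: 1) If $\delta_i>0$ for all $i$, then $k_*^\delta$ is finite. 2) $\mathcal P_k^\delta\in B_{\rho/2}(\mathcal P_0)$ for all $k\le k_*^\delta$. 3) $\|\mathcal P_{k+1}^\delta-\mathcal P^*\|^2\le\|\mathcal P_k^\delta-\mathcal P^*\|^2$ for $k=0,1,\dots,k_*^\delta$, and $\|\mathcal P_{k+1}^\delta-\mathcal P^*\|^2=\|\mathcal P_k^\delta-\mathcal P^*\|^2$ for $k>k_*^\delta$. Moreover, in the case of noisy data ($\delta_i>0$), $\|\tilde F_i(\mathcal P_{k_*^\delta}^\delta)-\mathcal M_i^\delta\|\le\tau\delta_i$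 for $i=0,\dots,r_{\mathrm{num}}-1$. 4) For exact data ($\delta_i=0$ for all $i$), $\mathcal P_k^\delta$ converges, as $k\to\infty$, to a solution of $\tilde F_i(\mathcal P)=\mathcal M_i$, $i=0,\dots,r_{\mathrm{num}}-1$. 5) Let $\boldsymbol\delta_m=(\delta_{0,m},\dots,\delta_{r_{\mathrm{num}}-1,m})$, $m\in\mathbb N$, with $\delta_{i,m}>0$ and $\lim_{m\to\infty}\max_i\delta_{i,m}=0$, and let $\mathcal M_i^{\boldsymbol\delta_m}\in Y$ satisfy $\|\mathcal M_i^{\boldsymbol\delta_m}-\mathcal M_i\|\le\delta_{i,m}$ for all $i$ and $m$. For each $m$, let $(\mathcal P_k^{\boldsymbol\delta_m})_{k\ge0}$ be the lLK iteration started at $\mathcal P_0$ with data $\mathcal M_i^{\boldsymbol\delta_m}$ and noise levels $\delta_{i,m}$, and $k_*^m$ its stopping index. Then $\mathcal P_{k_*^m}^{\boldsymbol\delta_m}$ converges, as $m\to\infty$, to a solution of $\tilde F_i(\mathcal P)=\mathcal M_i$, $i=0,\dots,r_{\mathrm{num}}-1$.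
   Context: Discrete MRI model. Let $p_{\mathrm{hor}},p_{\mathrm{ver}},r_{\mathrm{num}},b_{\mathrm{num}}$ be positive integers, $p_{\mathrm{num}}=p_{\mathrm{hor}}p_{\mathrm{ver}}$, and $\mathbb B=\{1,\dots,p_{\mathrm{hor}}\}\times\{1,\dots,p_{\mathrm{ver}}\}$, identified via a fixed enumeration with $\{0,\dots,p_{\mathrm{num}}-1\}$. Let $\mathbb M\subset\mathbb B$ be a given subset. Let $\tilde X=\{f\mid f:\mathbb B\to\mathbb C\}$ and $Y=\{g\mid g:\mathbb M\to\mathbb C\}$, with Euclidean norms $\|\cdot\|$ and inner products. The discrete Fourier transform $\mathcal F:\tilde X\to\tilde X$ is $(\mathcal F f)(m)=\sum_{n=0}^{p_{\mathrm{num}}-1}f(n)\exp(-2\pi i\,nm/p_{\mathrm{num}})$, and $\mathbf P:\tilde X\to Y$ is restriction, $(\mathbf P[f])(m)=f(m)$ for $m\in\mathbb M$. Let $\mathcal B_n:\mathbb B\to\mathbb C$ ($n=1,\dots,b_{\mathrm{num}}$) be given basis functions and $b_{j,n}\in\mathbb C$ ($j=0,\dots,r_{\mathrm{num}}-1$) known coefficients. Define the linear operators $$\tilde F_i(\mathcal P)=\sum_{n=1}^{b_{\mathrm{num}}}b_{i,n}\,\mathbf P[\mathcal F(\mathcal P\times\mathcal B_n)],\qquad i=0,\dots,r_{\mathrm{num}}-1,$$ where $\times$ is the pointwise product. $\tilde F_i^*$ denotes the adjoint, $\|\tilde F_i\|$ the operator norm, and $B_r(\cdot)$ the ball of radius $r$.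 lLK iteration for data $\mathcal M_i^\delta\in Y$ and noise levels $\delta_i$. Fix a constant $\tau>2$ and put $[k]=k \bmod r_{\mathrm{num}}\in\{0,\dots,r_{\mathrm{num}}-1\}$. A group of $r_{\mathrm{num}}$ subsequent steps starting at a multiple of $r_{\mathrm{num}}$ is called a cycle. Starting with $\mathcal P_0^\delta=\mathcal P_0$, set $$\mathcal P_{k+1}^\delta=\mathcal P_k^\delta-\omega_k\alpha_k s_k,\qquad \alpha_k\equiv1,\qquad s_k=\tilde F_{[k]}^*\big(\tilde F_{[k]}(\mathcal P_k^\delta)-\mathcal M_{[k]}^\delta\big),$$ where $\omega_k=1$ if $\|\tilde F_{[k]}(\mathcal P_k^\delta)-\mathcal M_{[k]}^\delta\|>\tau\delta_{[k]}$ and $\omega_k=0$ otherwise. Stopping index. The iteration is terminated when, for the first time, all iterates are equal within a cycle: $k_*^\delta$ is the smallest multiple of $r_{\mathrm{num}}$ such that $\mathcal P_{k_*^\delta}^\delta=\mathcal P_{k_*^\delta+1}^\delta=\dots=\mathcal P_{k_*^\delta+r_{\mathrm{num}}-1}^\delta$, with $k_*^\delta=\infty$ if no such index exists.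
   Formalization: Two printed formulas are false and are corrected: the stopping index requires equality of all iterates from k_* through k_*+r_num (not r_num−1), and part 2 gives the ball of radius ρ/2 around P^* instead of P_0. *)

theory Defs
  imports "HOL-Analysis.Analysis" "HOL-Library.Extended_Nat"
begin

section \<open>The discrete MRI operators\<close>

text \<open>
  Images are vectors \<^typ>\<open>complex ^ 'p\<close> over a finite type of pixels; for a
  \<open>p_hor\<close> by \<open>p_ver\<close> grid, \<open>'p\<close> is a product \<open>'h \<times> 'v\<close> with \<open>CARD('h) = p_hor\<close>
  and \<open>CARD('v) = p_ver\<close>.  The library norm on this type is the Euclidean norm.
  The argument \<open>e\<close> is the enumeration of the pixels by \<open>{0..<CARD('p)}\<close>.
\<close>

definition dft :: "('p::finite \<Rightarrow> nat) \<Rightarrow> complex ^ 'p \<Rightarrow> complex ^ 'p" where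
  "dft e f = (\<chi> m. \<Sum>n\<in>UNIV.
     f $ n * exp (- 2 * of_real pi * \<i> * of_nat (e n) * of_nat (e m) / of_nat CARD('p)))"

text \<open>
  Functions on a set \<open>\<MM>\<close> of pixels (possibly empty) are represented by their extensions by
  zero.  This embedding preserves norms and inner products.
\<close>

definition data_space :: "'p::finite set \<Rightarrow> (complex ^ 'p) set" where
  "data_space \<MM> = {g. \<forall>m. m \<notin> \<MM> \<longrightarrow> g $ m = 0}"

definition restriction :: "'p::finite set \<Rightarrow> complex ^ 'p \<Rightarrow> complex ^ 'p" where
  "restriction \<MM> f = (\<chi> m. if m \<in> \<MM> then f $ m else 0)"

text \<open>The product \<open>P * \<B> n\<close> of vectors is the pointwise one.\<close>

definition mri_operator ::
  "('p::finite \<Rightarrow> nat) \<Rightarrow> 'p set \<Rightarrow> nat \<Rightarrow> (nat \<Rightarrow> complex ^ 'p) \<Rightarrow> (nat \<Rightarrow> nat \<Rightarrow> complex) \<Rightarrow>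
    nat \<Rightarrow> complex ^ 'p \<Rightarrow> complex ^ 'p" where
  "mri_operator e \<MM> b_num \<B> b i P =
     (\<Sum>n=1..b_num. b i n *s restriction \<MM> (dft e (P * \<B> n)))"

lemma mri_operator_in_data_space: "mri_operator e \<MM> b_num \<B> b i P \<in> data_space \<MM>"
  by (simp add: mri_operator_def data_space_def restriction_def)

lemma dft_add: "dft e (f + g) = dft e f + dft e g"
  by (simp add: dft_def vec_eq_iff distrib_right sum.distrib)

lemma dft_scale: "dft e (c *s f) = c *s dft e f"
  by (simp add: dft_def vec_eq_iff sum_distrib_left mult.assoc)

lemma restriction_add: "restriction \<MM> (f + g) = restriction \<MM> f + restriction \<MM> g"
  by (simp add: restriction_def vec_eq_iff)

lemma restriction_scale: "restriction \<MM> (c *s f) = c *s restriction \<MM> f"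
  by (simp add: restriction_def vec_eq_iff)

lemma mri_operator_add:
  "mri_operator e \<MM> b_num \<B> b i (P + Q) =
     mri_operator e \<MM> b_num \<B> b i P + mri_operator e \<MM> b_num \<B> b i Q"
proof -
  have "(P + Q) * \<B> n = P * \<B> n + Q * \<B> n" for n
    by (simp add: vec_eq_iff distrib_right)
  then show ?thesis
    by (simp add: mri_operator_def dft_add restriction_add vector_add_ldistrib sum.distrib)
qed

lemma mri_operator_scale:
  "mri_operator e \<MM> b_num \<B> b i (c *s P) = c *s mri_operator e \<MM> b_num \<B> b i P"
proof -
  have "(c *s P) * \<B> n = c *s (P * \<B> n)" for n
    by (simp add: vec_eq_iff mult.assoc)
  then show ?thesis
    by (simp add: mri_operator_def dft_scale restriction_scale vec.scale_sum_right
        vector_smult_assoc mult.commute)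
qed

lemma scaleR_eq_scale: "r *\<^sub>R (x :: complex ^ 'p) = complex_of_real r *s x"
  by (simp add: vec_eq_iff scaleR_conv_of_real[where 'a = complex])

lemma linear_mri_operator: "linear (mri_operator e \<MM> b_num \<B> b i)"
  by (rule linearI) (simp_all add: mri_operator_add mri_operator_scale scaleR_eq_scale)

text \<open>
  The library constant \<^const>\<open>adjoint\<close> refers to the real inner product, which on
  \<^typ>\<open>complex ^ 'p\<close> is the real part of the Hermitian one.  For complex-linear operators
  both inner products yield the same adjoint.
\<close>

lemma inner_eq_Re_hermitian: "x \<bullet> y = Re (\<Sum>n\<in>UNIV. x $ n * cnj (y $ n))"
  for x y :: "complex ^ 'p"
  by (simp add: inner_vec_def inner_complex_def)

lemma hermitian_adjoint_mri_operator:
  fixes e :: "'p::finite \<Rightarrow> nat" and x y :: "complex ^ 'p" and b :: "nat \<Rightarrow> nat \<Rightarrow> complex"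
    and \<MM> \<B> b_num i
  defines "F \<equiv> mri_operator e \<MM> b_num \<B> b i"
  shows "(\<Sum>n\<in>UNIV. F x $ n * cnj (y $ n)) = (\<Sum>n\<in>UNIV. x $ n * cnj (adjoint F y $ n))"
    (is "?l x = ?r x")
proof (rule complex_eqI)
  have lin: "linear F" unfolding F_def by (rule linear_mri_operator)
  have re: "Re (?l z) = Re (?r z)" for z
    using adjoint_works[OF lin, of z y] by (simp add: inner_eq_Re_hermitian)
  show "Re (?l x) = Re (?r x)" by (rule re)
  have "?l (\<i> *s x) = \<i> * ?l x"
    by (simp add: F_def mri_operator_scale sum_distrib_left mult.assoc)
  moreover have "?r (\<i> *s x) = \<i> * ?r x"
    by (simp add: sum_distrib_left mult.assoc)
  ultimately have "Re (\<i> * ?l x) = Re (\<i> * ?r x)"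
    using re[of "\<i> *s x"] by metis
  then show "Im (?l x) = Im (?r x)" by simp
qed

section \<open>The loping Landweber-Kaczmarz iteration\<close>

definition loping_weight :: "real \<Rightarrow> real \<Rightarrow> 'b::real_normed_vector \<Rightarrow> real" where
  "loping_weight \<tau> \<delta> residual = (if norm residual > \<tau> * \<delta> then 1 else 0)"

primrec lLK ::
  "(nat \<Rightarrow> 'a::euclidean_space \<Rightarrow> 'b::euclidean_space) \<Rightarrow> nat \<Rightarrow> real \<Rightarrow> (nat \<Rightarrow> real) \<Rightarrow>
    (nat \<Rightarrow> real) \<Rightarrow> (nat \<Rightarrow> 'b) \<Rightarrow> 'a \<Rightarrow> nat \<Rightarrow> 'a" where
  "lLK F r_num \<tau> \<alpha> \<delta> M P0 0 = P0"
| "lLK F r_num \<tau> \<alpha> \<delta> M P0 (Suc k) =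
     (let P = lLK F r_num \<tau> \<alpha> \<delta> M P0 k;
          i = k mod r_num;
          residual = F i P - M i;
          s = adjoint (F i) residual
      in P - (loping_weight \<tau> (\<delta> i) residual * \<alpha> k) *\<^sub>R s)"

text \<open>
  A cycle consists of \<open>r_num\<close> steps, hence involves the \<open>r_num + 1\<close> iterates
  \<open>P k, \<dots>, P (k + r_num)\<close>; the iteration stops when none of the steps of a cycle changes the
  iterate.  (Requiring only \<open>P k = \<dots> = P (k + r_num - 1)\<close> would leave the last equation of
  the cycle untested; for \<open>r_num = 1\<close> it would always stop at \<open>0\<close>.)
  The infimum of the empty set is \<open>\<infinity>\<close>.
\<close>

definition stopping_index :: "nat \<Rightarrow> (nat \<Rightarrow> 'a) \<Rightarrow> enat" where
  "stopping_index r_num P = Inf {enat k |k. r_num dvd k \<and> (\<forall>j\<le>r_num. P (k + j) = P k)}"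

end

theory Submission
  imports Defs
begin

text \<open>
  Everything follows from one monotonicity estimate.  Suppose that step \<open>k\<close> is performed, so
  that its residual \<open>r\<close> satisfies \<open>norm r > \<tau> * \<delta>\<close>, and let \<open>x\<close> be any solution of the exact
  equations.  Expanding the square, moving the adjoint to the other side of the inner product
  and bounding the data error by \<open>\<delta>\<close> shows that the squared distance to \<open>x\<close> drops by at least
  \<open>norm r * (norm r - 2 * \<delta>)\<close>, which is at least \<open>(1 - 2 / \<tau>) * (norm r)\<^sup>2\<close> (lemma
  \<open>descent\<close>).  Skipped steps change nothing.  Hence the distance to \<^emph>\<open>every\<close> solution is
  nonincreasing, and the squared residuals of the performed steps are summable.

  Summability yields the stopping claim: with positive noise levels, a performed step has a
  residual bounded away from \<open>0\<close>, so only finitely many steps are performed and eventually a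
  whole cycle is skipped.  By strict descent, a cycle that leaves the iterate unchanged is one
  all of whose steps are skipped; this is the discrepancy principle, and it makes the iteration
  constant from then on.

  For exact data, a step is skipped only if its residual vanishes, so all residuals and all
  increments tend to \<open>0\<close>.  By boundedness and finite dimension the iterates at the beginnings of
  the cycles have a limit point \<open>Q\<close>; vanishing increments make \<open>Q\<close> a limit point along each
  position within the cycle, so \<open>Q\<close> solves every equation.  Now the distance to the solution
  \<open>Q\<close> itself is nonincreasing and has infimum \<open>0\<close>, so the whole sequence converges to \<open>Q\<close>.

  As the noise vanishes, each fixed iterate converges to the corresponding exact one (lemma
  \<open>lLK_stability\<close>), although the loping weights are discontinuous in the data: a weight can
  only fail to converge where the exact residual is \<open>0\<close>, and there the step is small with
  either weight.  Let \<open>Q\<close> be the limit for exact data.  Monotonicity of the noisy iterations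
  towards \<open>Q\<close> bounds the distance from the stopped iterate to \<open>Q\<close> by that from the iterate with
  any fixed index \<open>K\<close>; let the noise tend to \<open>0\<close> and then \<open>K\<close> to infinity.
\<close>

section \<open>Adjoints of nonexpansive operators\<close>

lemma norm_le_of_onorm_le_1:
  fixes f :: "'a::euclidean_space \<Rightarrow> 'b::real_normed_vector"
  assumes "linear f" "onorm f \<le> 1"
  shows "norm (f x) \<le> norm x"
proof -
  have "norm (f x) \<le> onorm f * norm x"
    using assms(1) by (intro onorm linear_conv_bounded_linear[THEN iffD1])
  also have "\<dots> \<le> 1 * norm x"
    using assms(2) by (intro mult_right_mono) auto
  finally show ?thesis by simp
qed

lemma norm_adjoint_le:
  fixes f :: "'a::euclidean_space \<Rightarrow> 'b::euclidean_space"
  assumes "linear f" "\<And>x. norm (f x) \<le> norm x"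
  shows "norm (adjoint f y) \<le> norm y"
proof -
  let ?z = "adjoint f y"
  have "norm ?z * norm ?z = f ?z \<bullet> y"
    using adjoint_works[OF assms(1), of ?z y]
    by (simp flip: power2_eq_square add: power2_norm_eq_inner)
  also have "\<dots> \<le> norm (f ?z) * norm y" by (rule norm_cauchy_schwarz)
  also have "\<dots> \<le> norm ?z * norm y" by (intro mult_right_mono assms(2)) auto
  finally have "norm ?z * norm ?z \<le> norm ?z * norm y" .
  then show ?thesis
    by (cases "?z = 0") (auto simp: mult_le_cancel_left)
qed

section \<open>Stopping indices\<close>

lemma stopping_index_eq_enatD:
  assumes "stopping_index r P = enat k"
  shows "r dvd k" "\<And>j. j \<le> r \<Longrightarrow> P (k + j) = P k"
proof -
  let ?A = "{enat k |k. r dvd k \<and> (\<forall>j\<le>r. P (k + j) = P k)}"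
  have "?A \<noteq> {}"
    using assms unfolding stopping_index_def Inf_enat_def by (metis (lifting) enat.distinct(1))
  then have "Inf ?A \<in> ?A"
    by (meson ex_in_conv wellorder_InfI)
  then have "enat k \<in> ?A"
    using assms unfolding stopping_index_def by simp
  then show "r dvd k" "\<And>j. j \<le> r \<Longrightarrow> P (k + j) = P k" by auto
qed

lemma stopping_index_finiteI:
  assumes "r dvd k" "\<And>j. j \<le> r \<Longrightarrow> P (k + j) = P k"
  shows "stopping_index r P < \<infinity>"
proof -
  have "stopping_index r P \<le> enat k"
    unfolding stopping_index_def using assms by (intro Inf_lower) auto
  then show ?thesis
    using enat_ord_simps(4) le_less_trans by blast
qed

section \<open>Monotonicity of the iteration\<close>

text \<open>
  Two data vectors occur: the iteration is driven by the measured data \<open>M\<delta>\<close>, while the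
  solutions it is compared with solve the equations for the exact data \<open>M\<close>.
\<close>

locale loping_landweber_kaczmarz =
  fixes F :: "nat \<Rightarrow> 'a::euclidean_space \<Rightarrow> 'b::euclidean_space"
    and r :: nat and \<tau> :: real and \<delta> :: "nat \<Rightarrow> real" and M M\<delta> :: "nat \<Rightarrow> 'b" and P0 :: 'a
  assumes linear_F: "i < r \<Longrightarrow> linear (F i)"
    and norm_F_le: "i < r \<Longrightarrow> norm (F i x) \<le> norm x"
    and r_pos: "0 < r"
    and tau: "\<tau> > 2"
    and noise: "i < r \<Longrightarrow> norm (M\<delta> i - M i) \<le> \<delta> i"
    and solvable: "\<exists>x. \<forall>i<r. F i x = M i"
begin

definition P :: "nat \<Rightarrow> 'a" where
  "P = lLK F r \<tau> (\<lambda>_. 1) \<delta> M\<delta> P0"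

definition residual :: "nat \<Rightarrow> 'b" where
  "residual k = F (k mod r) (P k) - M\<delta> (k mod r)"

definition performed :: "nat \<Rightarrow> bool" where
  "performed k \<longleftrightarrow> norm (residual k) > \<tau> * \<delta> (k mod r)"

definition solution :: "'a \<Rightarrow> bool" where
  "solution x \<longleftrightarrow> (\<forall>i<r. F i x = M i)"

lemma P_0: "P 0 = P0"
  by (simp add: P_def)

lemma P_Suc:
  "P (Suc k) = (if performed k then P k - adjoint (F (k mod r)) (residual k) else P k)"
  by (simp add: P_def residual_def performed_def loping_weight_def Let_def)

lemma delta_nonneg: "i < r \<Longrightarrow> 0 \<le> \<delta> i"
  using noise[of i] norm_ge_zero order_trans by blast

lemma mod_r_less: "k mod r < r"
  using r_pos by simp

lemma performed_residual_pos: "performed k \<Longrightarrow> norm (residual k) > 0"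
  using delta_nonneg[OF mod_r_less[of k]] tau unfolding performed_def
  by (smt (verit) mult_nonneg_nonneg)

text \<open>
  The residual \<open>res\<close> is \<open>F i (P k - x)\<close> up to a data error of norm at most \<open>\<delta> i\<close>.  Hence the
  inner product of the update direction with \<open>P k - x\<close> is at least
  \<open>(norm res)\<^sup>2 - \<delta> i * norm res\<close>.  It enters the expanded square twice, against a second-order
  term of at most \<open>(norm res)\<^sup>2\<close>, so \<open>\<delta> i < norm res / \<tau>\<close> leaves the claimed gain, which is
  positive because \<open>\<tau> > 2\<close>.
\<close>

lemma descent:
  assumes x: "solution x" and k: "performed k"
  shows "(norm (P (Suc k) - x))\<^sup>2 + (1 - 2 / \<tau>) * (norm (residual k))\<^sup>2 \<le> (norm (P k - x))\<^sup>2"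
proof -
  define i where "i = k mod r"
  define s where "s = adjoint (F i) (residual k)"
  let ?res = "residual k"
  have i: "i < r" using mod_r_less by (simp add: i_def)
  note lin = linear_F[OF i]
  have "s \<bullet> (P k - x) = ?res \<bullet> (F i (P k) - F i x)"
    using adjoint_works[OF lin, of "P k - x" ?res]
    by (simp add: s_def linear_diff[OF lin] inner_commute)
  also have "F i (P k) - F i x = ?res + (M\<delta> i - M i)"
    using x i by (simp add: residual_def i_def solution_def)
  also have "?res \<bullet> (?res + (M\<delta> i - M i)) = (norm ?res)\<^sup>2 + ?res \<bullet> (M\<delta> i - M i)"
    by (simp add: inner_add_right power2_norm_eq_inner)
  finally have eq: "s \<bullet> (P k - x) = (norm ?res)\<^sup>2 + ?res \<bullet> (M\<delta> i - M i)" .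
  have "\<bar>?res \<bullet> (M\<delta> i - M i)\<bar> \<le> norm ?res * norm (M\<delta> i - M i)"
    by (rule Cauchy_Schwarz_ineq2)
  also have "\<dots> \<le> norm ?res * \<delta> i"
    using noise[OF i] by (intro mult_left_mono) auto
  finally have err: "\<bar>?res \<bullet> (M\<delta> i - M i)\<bar> \<le> norm ?res * \<delta> i" .
  have "norm s \<le> norm ?res"
    unfolding s_def using norm_F_le[OF i] by (intro norm_adjoint_le[OF lin])
  then have s_le: "(norm s)\<^sup>2 \<le> (norm ?res)\<^sup>2" by (intro power_mono) auto
  have "\<delta> i \<le> norm ?res / \<tau>"
    using k tau by (simp add: performed_def i_def field_simps)
  then have "norm ?res * \<delta> i \<le> norm ?res * (norm ?res / \<tau>)"
    by (intro mult_left_mono) auto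
  then have delta_le: "norm ?res * \<delta> i \<le> (norm ?res)\<^sup>2 / \<tau>"
    by (simp add: power2_eq_square)
  have diff: "P (Suc k) - x = (P k - x) - s"
    using k by (simp add: P_Suc s_def i_def)
  have "(norm (P (Suc k) - x))\<^sup>2 = (norm (P k - x))\<^sup>2 - 2 * (s \<bullet> (P k - x)) + (norm s)\<^sup>2"
    using dot_norm_neg[of "P k - x" s] unfolding diff inner_commute[of "P k - x" s] by simp
  then have "(norm (P (Suc k) - x))\<^sup>2
      \<le> (norm (P k - x))\<^sup>2 - ((norm ?res)\<^sup>2 - 2 * ((norm ?res)\<^sup>2 / \<tau>))"
    using eq err s_le delta_le by linarith
  then show ?thesis by (simp add: algebra_simps)
qed

lemma monotone_step:
  assumes "solution x"
  shows "norm (P (Suc k) - x) \<le> norm (P k - x)"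
proof (cases "performed k")
  case True
  have "0 \<le> (1 - 2 / \<tau>) * (norm (residual k))\<^sup>2" using tau by simp
  then have "(norm (P (Suc k) - x))\<^sup>2 \<le> (norm (P k - x))\<^sup>2"
    using descent[OF assms True] by linarith
  then show ?thesis by (simp add: power2_le_iff_abs_le)
qed (simp add: P_Suc)

lemma monotone:
  assumes "solution x" "k \<le> l"
  shows "norm (P l - x) \<le> norm (P k - x)"
  using assms(2) monotone_step[OF assms(1)] by (rule lift_Suc_antimono_le[rotated])

text \<open>
  A performed step has a nonzero residual and therefore moves strictly closer to any solution;
  in particular its update direction cannot vanish.
\<close>

lemma unchanged_iff_skipped: "P (Suc k) = P k \<longleftrightarrow> \<not> performed k"
proof
  obtain x where x: "solution x" using solvable unfolding solution_def by blast
  assume eq: "P (Suc k) = P k"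
  show "\<not> performed k"
  proof
    assume k: "performed k"
    have "0 < (1 - 2 / \<tau>) * (norm (residual k))\<^sup>2"
      using performed_residual_pos[OF k] tau by simp
    then show False using descent[OF x k] eq by simp
  qed
qed (simp add: P_Suc)

text \<open>Telescoping the descent estimate bounds the total squared residual of performed steps.\<close>

lemma performed_residuals_tendsto_0:
  "(\<lambda>k. if performed k then (norm (residual k))\<^sup>2 else 0) \<longlonglongrightarrow> 0" (is "?g \<longlonglongrightarrow> 0")
proof -
  obtain x where x: "solution x" using solvable unfolding solution_def by blast
  let ?c = "1 - 2 / \<tau>"
  have c: "?c > 0" using tau by simp
  have tele: "(norm (P n - x))\<^sup>2 + ?c * (\<Sum>k<n. ?g k) \<le> (norm (P 0 - x))\<^sup>2" for n
  proof (induction n)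
    case (Suc n)
    have "(norm (P (Suc n) - x))\<^sup>2 + ?c * ?g n \<le> (norm (P n - x))\<^sup>2"
      using descent[OF x, of n] by (cases "performed n") (auto simp: P_Suc)
    with Suc show ?case by (simp add: distrib_left)
  qed simp
  have "(\<Sum>k<n. ?g k) \<le> (norm (P 0 - x))\<^sup>2 / ?c" for n
  proof -
    have "?c * (\<Sum>k<n. ?g k) \<le> (norm (P 0 - x))\<^sup>2"
      using tele[of n] zero_le_power2[of "norm (P n - x)"] by linarith
    then show ?thesis using c by (simp add: pos_le_divide_eq mult.commute)
  qed
  then have "summable ?g"
    by (intro bounded_imp_summable[of _ "(norm (P 0 - x))\<^sup>2 / ?c"])
      (auto simp flip: lessThan_Suc_atMost simp del: sum.lessThan_Suc)
  then show ?thesis by (rule summable_LIMSEQ_zero)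
qed

section \<open>Termination\<close>

text \<open>
  As long as the iterate stays at \<open>P k\<close>, the residuals of the cycle are those of the single
  point \<open>P k\<close>, one for each equation.
\<close>

lemma unchanged_cycle_iff_discrepancy:
  assumes k: "r dvd k"
  shows "(\<forall>j\<le>r. P (k + j) = P k) \<longleftrightarrow> (\<forall>i<r. norm (F i (P k) - M\<delta> i) \<le> \<tau> * \<delta> i)"
proof
  assume eq: "\<forall>j\<le>r. P (k + j) = P k"
  show "\<forall>i<r. norm (F i (P k) - M\<delta> i) \<le> \<tau> * \<delta> i"
  proof (intro allI impI)
    fix i assume i: "i < r"
    then have "P (Suc (k + i)) = P k" "P (k + i) = P k"
      using eq[rule_format, of "Suc i"] eq[rule_format, of i] by auto
    then have "\<not> performed (k + i)" using unchanged_iff_skipped by metis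
    moreover have "(k + i) mod r = i" using k i by (auto simp: dvd_def)
    ultimately show "norm (F i (P k) - M\<delta> i) \<le> \<tau> * \<delta> i"
      using \<open>P (k + i) = P k\<close> by (simp add: performed_def residual_def)
  qed
next
  assume small: "\<forall>i<r. norm (F i (P k) - M\<delta> i) \<le> \<tau> * \<delta> i"
  have "P (k + j) = P k" for j
  proof (induction j)
    case (Suc j)
    have "\<not> performed (k + j)"
      using small Suc mod_r_less[of "k + j"] by (auto simp: performed_def residual_def not_less)
    then show ?case using Suc by (simp add: P_Suc)
  qed simp
  then show "\<forall>j\<le>r. P (k + j) = P k" by blast
qed

lemma constant_after_unchanged_cycle:
  assumes "r dvd k" "\<forall>j\<le>r. P (k + j) = P k" "k \<le> l"
  shows "P l = P k"
  using assms(3)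
proof (induction l rule: dec_induct)
  case (step l)
  have "\<not> performed l"
    using unchanged_cycle_iff_discrepancy[OF assms(1)] assms(2) step.IH mod_r_less[of l]
    by (auto simp: performed_def residual_def not_less)
  then show ?case using step.IH by (simp add: P_Suc)
qed simp

lemma constant_after_stopping:
  assumes "stopping_index r P = enat k" "k \<le> l"
  shows "P l = P k"
  using constant_after_unchanged_cycle stopping_index_eq_enatD[OF assms(1)] assms(2) by blast

lemma stopping_index_finite:
  assumes pos: "\<And>i. i < r \<Longrightarrow> \<delta> i > 0"
  shows "stopping_index r P < \<infinity>"
proof -
  define d where "d = Min (\<delta> ` {..<r})"
  have d_le: "d \<le> \<delta> i" if "i < r" for i
    using that by (simp add: d_def)
  have d_pos: "d > 0"
    using pos r_pos by (subst d_def, subst Min_gr_iff) auto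
  have "\<forall>\<^sub>F k in sequentially.
      (if performed k then (norm (residual k))\<^sup>2 else 0) < (\<tau> * d)\<^sup>2"
    using performed_residuals_tendsto_0 by (rule order_tendstoD) (use tau d_pos in simp)
  then obtain N where
    N: "\<And>k. k \<ge> N \<Longrightarrow> (if performed k then (norm (residual k))\<^sup>2 else 0) < (\<tau> * d)\<^sup>2"
    by (auto simp: eventually_sequentially)
  have skipped: "\<not> performed k" if "k \<ge> N" for k
  proof
    assume k: "performed k"
    have "\<tau> * d \<le> \<tau> * \<delta> (k mod r)" using d_le[OF mod_r_less] tau by simp
    then have "\<tau> * d \<le> norm (residual k)" using k by (simp add: performed_def)
    then have "(\<tau> * d)\<^sup>2 \<le> (norm (residual k))\<^sup>2" using tau d_pos by (intro power_mono) auto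
    then show False using N[OF that] k by simp
  qed
  have N_le: "N \<le> r * N" using r_pos by simp
  have "P (r * N + j) = P (r * N)" for j
    using skipped[of "r * N + j" for j] N_le by (induction j) (simp_all add: P_Suc trans_le_add1)
  then show ?thesis by (intro stopping_index_finiteI[of r "r * N"]) auto
qed

lemma discrepancy_at_stopping:
  assumes "stopping_index r P = enat k" "i < r"
  shows "norm (F i (P k) - M\<delta> i) \<le> \<tau> * \<delta> i"
  using unchanged_cycle_iff_discrepancy stopping_index_eq_enatD[OF assms(1)] assms(2) by blast

text \<open>
  Before the stopping index this is monotonicity, afterwards the iterates coincide with the
  stopped one.
\<close>

lemma stopped_iterate_closest:
  assumes "solution x" "stopping_index r P = enat k"
  shows "norm (P k - x) \<le> norm (P l - x)"
  using monotone[OF assms(1), of l k] constant_after_stopping[OF assms(2), of l]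
  by (cases "l \<le> k") auto

section \<open>Convergence for exact data\<close>

lemma exact_data_converges:
  assumes exact: "\<And>i. i < r \<Longrightarrow> \<delta> i = 0"
  shows "\<exists>Q. P \<longlonglongrightarrow> Q \<and> solution Q"
proof -
  obtain x where x: "solution x" using solvable unfolding solution_def by blast
  have data: "M\<delta> i = M i" if "i < r" for i
    using noise[OF that] exact[OF that] by simp
  have performed_iff: "performed k \<longleftrightarrow> residual k \<noteq> 0" for k
    using exact[OF mod_r_less[of k]] by (simp add: performed_def)
  have sq: "(\<lambda>k. (norm (residual k))\<^sup>2) \<longlonglongrightarrow> 0"
    using performed_residuals_tendsto_0
    by (rule Lim_transform_eventually) (auto simp: performed_iff)
  have norm_res: "(\<lambda>k. norm (residual k)) \<longlonglongrightarrow> 0"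
    using tendsto_real_sqrt[OF sq] by simp
  then have res: "residual \<longlonglongrightarrow> 0" by (rule tendsto_norm_zero_cancel)
  have incr: "(\<lambda>k. P (Suc k) - P k) \<longlonglongrightarrow> 0"
  proof (rule Lim_null_comparison[OF _ norm_res])
    have "norm (P (Suc k) - P k) \<le> norm (residual k)" for k
      using norm_adjoint_le[OF linear_F[OF mod_r_less] norm_F_le[OF mod_r_less]] by (simp add: P_Suc)
    then show "\<forall>\<^sub>F k in sequentially. norm (P (Suc k) - P k) \<le> norm (residual k)" by simp
  qed
  have "P k \<in> cball x (norm (P 0 - x))" for k
    using monotone[OF x, of 0 k] by (simp add: dist_norm norm_minus_commute)
  then have "range (\<lambda>c. P (r * c)) \<subseteq> cball x (norm (P 0 - x))" by auto
  then have "bounded (range (\<lambda>c. P (r * c)))"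
    using bounded_cball bounded_subset by blast
  then obtain Q \<phi> where phi: "strict_mono \<phi>" and "((\<lambda>c. P (r * c)) \<circ> \<phi>) \<longlonglongrightarrow> Q"
    using bounded_imp_convergent_subsequence by blast
  then have lim0: "(\<lambda>n. P (r * \<phi> n)) \<longlonglongrightarrow> Q" by (simp add: o_def)
  have at_top: "filterlim (\<lambda>n. r * \<phi> n + j) sequentially sequentially" for j
  proof (rule filterlim_at_top_mono[OF filterlim_subseq[OF phi]])
    have "\<phi> n \<le> r * \<phi> n + j" for n using r_pos by (simp add: trans_le_add1)
    then show "\<forall>\<^sub>F n in sequentially. \<phi> n \<le> r * \<phi> n + j" by simp
  qed
  \<comment> \<open>One subsequence for all equations: position \<open>j\<close> of the cycle tests equation \<open>j\<close>.\<close>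
  have lim: "(\<lambda>n. P (r * \<phi> n + j)) \<longlonglongrightarrow> Q" for j
  proof (induction j)
    case (Suc j)
    show ?case
      using tendsto_add[OF Suc filterlim_compose[OF incr at_top[of j]]] by simp
  qed (simp add: lim0)
  have Q: "solution Q"
    unfolding solution_def
  proof (intro allI impI)
    fix i assume i: "i < r"
    have bl: "bounded_linear (F i)" using linear_F[OF i] by (rule linear_conv_bounded_linear[THEN iffD1])
    have "(\<lambda>n. F i (P (r * \<phi> n + i)) - M i) \<longlonglongrightarrow> F i Q - M i"
      by (intro tendsto_diff bounded_linear.tendsto[OF bl] lim tendsto_const)
    moreover have "(\<lambda>n. F i (P (r * \<phi> n + i)) - M i) \<longlonglongrightarrow> 0"
      using filterlim_compose[OF res at_top[of i]] i by (simp add: residual_def data)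
    ultimately show "F i Q = M i" using LIMSEQ_unique by fastforce
  qed
  have "P \<longlonglongrightarrow> Q"
  proof (rule LIMSEQ_I)
    fix \<epsilon> :: real assume "\<epsilon> > 0"
    then obtain n where n: "norm (P (r * \<phi> n) - Q) < \<epsilon>"
      using LIMSEQ_D[OF lim0] by blast
    then show "\<exists>N. \<forall>k\<ge>N. norm (P k - Q) < \<epsilon>"
      using monotone[OF Q] le_less_trans by blast
  qed
  with Q show ?thesis by blast
qed

end

section \<open>Stability with respect to the noise\<close>

text \<open>
  At a step with exact residual \<open>0\<close> the loping weights of the noisy iterations may oscillate, but
  the increments still vanish in the limit because the weights are bounded.  At a step with
  nonzero exact residual the weights are eventually \<open>1\<close>.
\<close>

lemma lLK_stability:
  fixes F :: "nat \<Rightarrow> 'a::euclidean_space \<Rightarrow> 'b::euclidean_space"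
  assumes lin: "\<And>i. i < r \<Longrightarrow> linear (F i)" and r: "0 < r"
    and deltas: "\<And>i. i < r \<Longrightarrow> (\<lambda>m. \<delta>s m i) \<longlonglongrightarrow> 0"
    and data: "\<And>i. i < r \<Longrightarrow> (\<lambda>m. Ms m i) \<longlonglongrightarrow> M i"
  shows "(\<lambda>m. lLK F r \<tau> (\<lambda>_. 1) (\<delta>s m) (Ms m) P0 k) \<longlonglongrightarrow> lLK F r \<tau> (\<lambda>_. 1) (\<lambda>_. 0) M P0 k"
proof (induction k)
  case (Suc k)
  define i where "i = k mod r"
  define p where "p m = lLK F r \<tau> (\<lambda>_. 1) (\<delta>s m) (Ms m) P0 k" for m
  define q where "q = lLK F r \<tau> (\<lambda>_. 1) (\<lambda>_. 0) M P0 k"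
  define w where "w m = loping_weight \<tau> (\<delta>s m i) (F i (p m) - Ms m i)" for m
  define v where "v = loping_weight \<tau> 0 (F i q - M i)"
  have i: "i < r" using r by (simp add: i_def)
  have bl: "bounded_linear (F i)" using lin[OF i] by (rule linear_conv_bounded_linear[THEN iffD1])
  have bl': "bounded_linear (adjoint (F i))"
    using adjoint_linear[OF lin[OF i]] by (rule linear_conv_bounded_linear[THEN iffD1])
  have p: "p \<longlonglongrightarrow> q" using Suc by (simp add: p_def[abs_def] q_def)
  have res: "(\<lambda>m. F i (p m) - Ms m i) \<longlonglongrightarrow> F i q - M i"
    by (intro tendsto_diff bounded_linear.tendsto[OF bl] p data i)
  have adj: "(\<lambda>m. adjoint (F i) (F i (p m) - Ms m i)) \<longlonglongrightarrow> adjoint (F i) (F i q - M i)"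
    by (rule bounded_linear.tendsto[OF bl' res])
  have step: "(\<lambda>m. w m *\<^sub>R adjoint (F i) (F i (p m) - Ms m i))
      \<longlonglongrightarrow> v *\<^sub>R adjoint (F i) (F i q - M i)"
  proof (cases "F i q - M i = 0")
    case True
    then have adj0: "(\<lambda>m. adjoint (F i) (F i (p m) - Ms m i)) \<longlonglongrightarrow> 0"
      using adj by (simp add: linear_0[OF adjoint_linear[OF lin[OF i]]])
    have "norm (w m *\<^sub>R adjoint (F i) (F i (p m) - Ms m i))
        \<le> norm (adjoint (F i) (F i (p m) - Ms m i))" for m
      by (simp add: w_def loping_weight_def)
    then have "(\<lambda>m. w m *\<^sub>R adjoint (F i) (F i (p m) - Ms m i)) \<longlonglongrightarrow> 0"
      by (intro Lim_null_comparison[OF _ tendsto_norm_zero[OF adj0]]) simp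
    with True show ?thesis by (simp add: linear_0[OF adjoint_linear[OF lin[OF i]]])
  next
    case False
    have "(\<lambda>m. norm (F i (p m) - Ms m i) - \<tau> * \<delta>s m i) \<longlonglongrightarrow> norm (F i q - M i) - \<tau> * 0"
      by (intro tendsto_intros res deltas i)
    then have "\<forall>\<^sub>F m in sequentially. norm (F i (p m) - Ms m i) - \<tau> * \<delta>s m i > 0"
      by (rule order_tendstoD) (use False in simp)
    then have "\<forall>\<^sub>F m in sequentially. w m = v"
      by eventually_elim (use False in \<open>simp add: w_def v_def loping_weight_def\<close>)
    then have "w \<longlonglongrightarrow> v" by (rule tendsto_eventually)
    then show ?thesis using adj by (rule tendsto_scaleR)
  qed
  show ?case
    using tendsto_diff[OF p step]
    by (simp add: Let_def i_def p_def[abs_def] q_def w_def[abs_def] v_def)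
qed simp

section \<open>The loping Landweber-Kaczmarz method for the MRI operators\<close>

theorem theorem4p4:
  fixes e :: "'h::finite \<times> 'v::finite \<Rightarrow> nat"
    and \<MM> :: "('h \<times> 'v) set"
    and \<B> :: "nat \<Rightarrow> complex ^ ('h \<times> 'v)"
    and b :: "nat \<Rightarrow> nat \<Rightarrow> complex"
    and b_num r_num :: nat
    and F :: "nat \<Rightarrow> complex ^ ('h \<times> 'v) \<Rightarrow> complex ^ ('h \<times> 'v)"
    and P0 Pstar :: "complex ^ ('h \<times> 'v)"
    and M M\<delta> :: "nat \<Rightarrow> complex ^ ('h \<times> 'v)"
    and \<delta> :: "nat \<Rightarrow> real"
    and \<tau> \<rho> :: real
    and P :: "nat \<Rightarrow> complex ^ ('h \<times> 'v)"
    and kstar :: enat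
  assumes enumeration: "bij_betw e UNIV {0..<CARD('h) * CARD('v)}"
    and b_num_pos: "b_num \<ge> 1"
    and r_num_pos: "r_num \<ge> 1"
    and F_eq: "F = mri_operator e \<MM> b_num \<B> b"
    and F_norm: "\<forall>i<r_num. onorm (F i) \<le> 1"
    and tau: "\<tau> > 2"
    and rho: "\<rho> > 0"
    and M_in: "\<forall>i<r_num. M i \<in> data_space \<MM>"
    and Pstar_ball: "Pstar \<in> ball P0 (\<rho> / 2)"
    and Pstar_solution: "\<forall>i<r_num. F i Pstar = M i"
    and M\<delta>_in: "\<forall>i<r_num. M\<delta> i \<in> data_space \<MM>"
    and noise: "\<forall>i<r_num. norm (M\<delta> i - M i) \<le> \<delta> i"
    and noisy_or_exact: "(\<forall>i<r_num. \<delta> i > 0) \<or> (\<forall>i<r_num. \<delta> i = 0)"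
    and P_eq: "P = lLK F r_num \<tau> (\<lambda>_. 1) \<delta> M\<delta> P0"
    and kstar_eq: "kstar = stopping_index r_num P"
  shows "((\<forall>i<r_num. \<delta> i > 0) \<longrightarrow> kstar < \<infinity>)
    \<and> (\<forall>k. enat k \<le> kstar \<longrightarrow> P k \<in> ball Pstar (\<rho> / 2))
    \<and> ((\<forall>k. enat k \<le> kstar \<longrightarrow> (norm (P (Suc k) - Pstar))\<^sup>2 \<le> (norm (P k - Pstar))\<^sup>2)
       \<and> (\<forall>k. kstar < enat k \<longrightarrow> (norm (P (Suc k) - Pstar))\<^sup>2 = (norm (P k - Pstar))\<^sup>2)
       \<and> ((\<forall>i<r_num. \<delta> i > 0) \<longrightarrow>
            (\<forall>i<r_num. norm (F i (P (the_enat kstar)) - M\<delta> i) \<le> \<tau> * \<delta> i)))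
    \<and> ((\<forall>i<r_num. \<delta> i = 0) \<longrightarrow>
         (\<exists>Q. P \<longlonglongrightarrow> Q \<and> (\<forall>i<r_num. F i Q = M i)))
    \<and> (\<forall>\<delta>s Ms.
         (\<forall>m. \<forall>i<r_num. \<delta>s m i > 0) \<and>
         (\<lambda>m. Max (\<delta>s m ` {..<r_num})) \<longlonglongrightarrow> 0 \<and>
         (\<forall>m. \<forall>i<r_num. Ms m i \<in> data_space \<MM> \<and> norm (Ms m i - M i) \<le> \<delta>s m i) \<longrightarrow>
         (\<exists>Q. (\<lambda>m. let Pm = lLK F r_num \<tau> (\<lambda>_. 1) (\<delta>s m) (Ms m) P0
                   in Pm (the_enat (stopping_index r_num Pm))) \<longlonglongrightarrow> Q
              \<and> (\<forall>i<r_num. F i Q = M i)))"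
proof -
  have lin: "linear (F i)" for i
    unfolding F_eq by (rule linear_mri_operator)
  have nonexp: "norm (F i x) \<le> norm x" if "i < r_num" for i x
    using norm_le_of_onorm_le_1[OF lin] F_norm that by blast
  have llk: "loping_landweber_kaczmarz F r_num \<tau> d M D"
    if "\<forall>i<r_num. norm (D i - M i) \<le> d i" for d D
    by (rule loping_landweber_kaczmarz.intro)
      (use lin nonexp r_num_pos tau that Pstar_solution in auto)
  interpret L: loping_landweber_kaczmarz F r_num \<tau> \<delta> M M\<delta> P0
    by (rule llk[OF noise])
  have P: "P = L.P" by (simp add: P_eq L.P_def)
  have Pstar: "L.solution Pstar" using Pstar_solution by (simp add: L.solution_def)

  have stops: "kstar < \<infinity>" if "\<forall>i<r_num. \<delta> i > 0"
    using L.stopping_index_finite that by (simp add: kstar_eq P)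
  have in_ball: "P k \<in> ball Pstar (\<rho> / 2)" for k
    using L.monotone[OF Pstar, of 0 k] Pstar_ball
    by (simp add: P L.P_0 dist_norm norm_minus_commute)
  have decreasing: "(norm (P (Suc k) - Pstar))\<^sup>2 \<le> (norm (P k - Pstar))\<^sup>2" for k
    using L.monotone_step[OF Pstar] by (simp add: P power_mono)
  have unchanged: "(norm (P (Suc k) - Pstar))\<^sup>2 = (norm (P k - Pstar))\<^sup>2"
    if less: "kstar < enat k" for k
  proof -
    obtain l where l: "kstar = enat l" using less by (cases kstar) auto
    have "stopping_index r_num L.P = enat l" using l by (simp add: kstar_eq P)
    note stationary = L.constant_after_stopping[OF this]
    have "P (Suc k) = P l" "P k = P l"
      unfolding P using less l by (auto intro!: stationary)
    then show ?thesis by simp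
  qed
  have discrepancy: "norm (F i (P (the_enat kstar)) - M\<delta> i) \<le> \<tau> * \<delta> i"
    if pos: "\<forall>i<r_num. \<delta> i > 0" and i: "i < r_num" for i
  proof -
    obtain l where "kstar = enat l" using stops[OF pos] by (cases kstar) auto
    then show ?thesis using L.discrepancy_at_stopping i by (simp add: kstar_eq P)
  qed
  have exact: "\<exists>Q. P \<longlonglongrightarrow> Q \<and> (\<forall>i<r_num. F i Q = M i)" if "\<forall>i<r_num. \<delta> i = 0"
    using L.exact_data_converges that by (simp add: P L.solution_def)

  have vanishing: "\<exists>Q. (\<lambda>m. let Pm = lLK F r_num \<tau> (\<lambda>_. 1) (\<delta>s m) (Ms m) P0
                   in Pm (the_enat (stopping_index r_num Pm))) \<longlonglongrightarrow> Q
              \<and> (\<forall>i<r_num. F i Q = M i)"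
    if pos: "\<forall>m. \<forall>i<r_num. \<delta>s m i > 0"
      and max: "(\<lambda>m. Max (\<delta>s m ` {..<r_num})) \<longlonglongrightarrow> 0"
      and data: "\<forall>m. \<forall>i<r_num. Ms m i \<in> data_space \<MM> \<and> norm (Ms m i - M i) \<le> \<delta>s m i"
    for \<delta>s :: "nat \<Rightarrow> nat \<Rightarrow> real" and Ms :: "nat \<Rightarrow> nat \<Rightarrow> complex ^ ('h \<times> 'v)"
  proof -
    define p where "p m = lLK F r_num \<tau> (\<lambda>_. 1) (\<delta>s m) (Ms m) P0" for m
    define stop where "stop m = the_enat (stopping_index r_num (p m))" for m
    interpret E: loping_landweber_kaczmarz F r_num \<tau> "\<lambda>_. 0" M M P0
      by (rule llk) simp
    obtain Q where lim: "E.P \<longlonglongrightarrow> Q" and Q: "E.solution Q"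
      using E.exact_data_converges by auto
    have deltas: "(\<lambda>m. \<delta>s m i) \<longlonglongrightarrow> 0" if i: "i < r_num" for i
    proof (rule tendsto_sandwich[OF _ _ tendsto_const max])
      show "\<forall>\<^sub>F m in sequentially. 0 \<le> \<delta>s m i" using pos i by (simp add: less_imp_le)
      show "\<forall>\<^sub>F m in sequentially. \<delta>s m i \<le> Max (\<delta>s m ` {..<r_num})" using i by simp
    qed
    have Ms: "(\<lambda>m. Ms m i) \<longlonglongrightarrow> M i" if i: "i < r_num" for i
    proof (rule LIM_zero_cancel, rule Lim_null_comparison[OF _ deltas[OF i]])
      show "\<forall>\<^sub>F m in sequentially. norm (Ms m i - M i) \<le> \<delta>s m i" using data i by simp
    qed
    have stable: "(\<lambda>m. p m k) \<longlonglongrightarrow> E.P k" for k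
      unfolding p_def E.P_def
      using r_num_pos by (intro lLK_stability lin deltas Ms) auto
    \<comment> \<open>\<open>Q\<close> solves the exact equations, so each noisy iteration is monotone towards it.\<close>
    have closest: "norm (p m (stop m) - Q) \<le> norm (p m k - Q)" for m k
    proof -
      interpret N: loping_landweber_kaczmarz F r_num \<tau> "\<delta>s m" M "Ms m" P0
        by (rule llk) (use data in simp)
      have p: "p m = N.P" by (simp add: p_def N.P_def)
      have "stopping_index r_num (p m) < \<infinity>"
        using N.stopping_index_finite pos by (simp add: p)
      then have "stopping_index r_num (p m) = enat (stop m)"
        by (cases "stopping_index r_num (p m)") (auto simp: stop_def)
      then show ?thesis
        using N.stopped_iterate_closest[of Q] Q by (simp add: p N.solution_def E.solution_def)
    qed
    have "(\<lambda>m. p m (stop m)) \<longlonglongrightarrow> Q"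
    proof (rule LIMSEQ_I)
      fix \<epsilon> :: real assume eps: "\<epsilon> > 0"
      obtain K where K: "norm (E.P K - Q) < \<epsilon>"
        using LIMSEQ_D[OF lim eps] by blast
      have "(\<lambda>m. norm (p m K - Q)) \<longlonglongrightarrow> norm (E.P K - Q)"
        by (intro tendsto_intros stable)
      then have "\<forall>\<^sub>F m in sequentially. norm (p m K - Q) < \<epsilon>"
        using K by (rule order_tendstoD)
      then show "\<exists>N. \<forall>m\<ge>N. norm (p m (stop m) - Q) < \<epsilon>"
        unfolding eventually_sequentially using closest le_less_trans by blast
    qed
    then show ?thesis
      using Q by (auto simp: E.solution_def Let_def p_def[abs_def] stop_def[abs_def])
  qed

  show ?thesis
    using stops in_ball decreasing unchanged discrepancy exact vanishing
    by (intro conjI allI impI) auto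
qed

end
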